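(* Let $Q_n$ be the $n$-dimensional hypercube graph. The system over $\mathbb F_2$ requiring that every $4$-cycle of $Q_n$ be unbalanced, i.e. $s\cdot\chi_C=1$ for every $4$-cycle $C$, is consistent, and every solution $\sigma$ satisfies $A_\sigma^2=nI$; consequently $\rho(A_\sigma)=\sqrt n$ for the entire affine solution family.
   Context: A signing of a graph with edge set $E$ is $\sigma\in\{\pm1\}^E$, encoded by $s\in\mathbb F_2^E$ with $\sigma_e=(-1)^{s_e}$; $A_\sigma$ is the signed adjacency matrix with $uv$ entry $\sigma_{uv}$ if $uv\in E$ and $0$ otherwise; $\rho(A_\sigma)=\max_i|\lambda_i(A_\sigma)|$. For a cycle $C$, $\chi_C\in\mathbb F_2^E$ is the indicator vector of its edge set; $C$ is unbalanced if $s\cdot\chi_C=1$, i.e. the product of its edge signs is $-1$. *)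

theory Defs
  imports "HOL-Library.Z2" "Jordan_Normal_Form.Spectral_Radius"
begin

text \<open>
  A simple graph is given by a vertex set and a set \<open>E\<close> of edges, each edge being a
  two-element set of vertices. The field with two elements is the type \<^typ>\<open>bit\<close>.
  A vector in $\mathbb{F}_2^E$ is represented by a function on all sets of vertices, of which
  only the values on \<open>E\<close> are ever used.
\<close>

definition is_cycle :: "'v set set \<Rightarrow> 'v list \<Rightarrow> bool" where
  "is_cycle E c \<longleftrightarrow> 3 \<le> length c \<and> distinct c \<and>
     (\<forall>i<length c. {c ! i, c ! (Suc i mod length c)} \<in> E)"

definition cycle_edges :: "'v list \<Rightarrow> 'v set set" where
  "cycle_edges c = {{c ! i, c ! (Suc i mod length c)} | i. i < length c}"

definition cycle_indicator :: "'v list \<Rightarrow> 'v set \<Rightarrow> bit" where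
  "cycle_indicator c e = (if e \<in> cycle_edges c then 1 else 0)"

definition dot :: "'e set \<Rightarrow> ('e \<Rightarrow> bit) \<Rightarrow> ('e \<Rightarrow> bit) \<Rightarrow> bit" where
  "dot E s x = (\<Sum>e\<in>E. s e * x e)"

definition unbalanced :: "'v set set \<Rightarrow> ('v set \<Rightarrow> bit) \<Rightarrow> 'v list \<Rightarrow> bool" where
  "unbalanced E s c \<longleftrightarrow> dot E s (cycle_indicator c) = 1"

text \<open>The sign $\sigma_e = (-1)^{s_e}$.\<close>

definition signing :: "('e \<Rightarrow> bit) \<Rightarrow> 'e \<Rightarrow> real" where
  "signing s e = (if s e = 1 then - 1 else 1)"

text \<open>
  Matrices are indexed by natural numbers, so the vertex set is enumerated by a list
  \<open>vs\<close>: row and column \<open>i\<close> belong to the vertex \<open>vs ! i\<close>.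
\<close>

definition signed_adj_mat :: "'v list \<Rightarrow> 'v set set \<Rightarrow> ('v set \<Rightarrow> real) \<Rightarrow> real mat" where
  "signed_adj_mat vs E \<sigma> = mat (length vs) (length vs)
     (\<lambda>(i, j). if {vs ! i, vs ! j} \<in> E then \<sigma> {vs ! i, vs ! j} else 0)"

definition real_spectral_radius :: "real mat \<Rightarrow> real" where
  "real_spectral_radius A = spectral_radius (map_mat complex_of_real A)"

definition cube_verts :: "nat \<Rightarrow> bit list set" where
  "cube_verts n = {u. length u = n}"

definition cube_edges :: "nat \<Rightarrow> bit list set set" where
  "cube_edges n = {{u, v} | u v. u \<in> cube_verts n \<and> v \<in> cube_verts n \<and>
     card {i. i < n \<and> u ! i \<noteq> v ! i} = 1}"

definition cube_solutions :: "nat \<Rightarrow> (bit list set \<Rightarrow> bit) set" where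
  "cube_solutions n = {s. \<forall>c. is_cycle (cube_edges n) c \<and> length c = 4 \<longrightarrow>
     unbalanced (cube_edges n) s c}"

end

theory Submission
  imports Defs
begin

text \<open>
  The entry of $A_\sigma^2$ at vertices $u \ne v$ sums over the common neighbours of $u$ and $v$.
  If there are any, there are exactly two, and they form a 4-cycle with $u$ and $v$; since it is
  unbalanced, the two terms cancel. A solution is $s_e = u_0 + \dots + u_{i-1}$ for the edge $e$
  that flips coordinate $i$ of $u$: around a 4-cycle in directions $i$ and $j$ each prefix parity
  occurs twice, and exactly one of the two pairs is changed by the other flip.
\<close>

text \<open>Otherwise the simplifier leaves ring notation for bit operations.\<close>

declare add_bit_eq_xor [simp del] mult_bit_eq_and [simp del]

section \<open>Coordinate flips and their compositions\<close>

definition flip :: "nat \<Rightarrow> bit list \<Rightarrow> bit list" where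
  "flip i u = u[i := u ! i + 1]"

lemma length_flip [simp]: "length (flip i u) = length u"
  by (simp add: flip_def)

lemma nth_flip: "i < length u \<Longrightarrow> flip i u ! k = (if k = i then u ! k + 1 else u ! k)"
  by (simp add: flip_def)

lemma bit_add_one_neq [simp]: "(b :: bit) + 1 \<noteq> b"
  by (cases b) auto

lemma bit_add_one_one [simp]: "(b :: bit) + 1 + 1 = b"
  by (cases b) auto

lemma bit_neq_iff: "(a :: bit) \<noteq> b \<longleftrightarrow> a = b + 1"
  by (cases a; cases b) auto

lemma flip_flip [simp]: "i < length u \<Longrightarrow> flip i (flip i u) = u"
  by (auto simp: list_eq_iff_nth_eq nth_flip)

lemma flip_commute:
  assumes "i < length u" "j < length u"
  shows "flip i (flip j u) = flip j (flip i u)"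
  using assms by (auto simp: list_eq_iff_nth_eq nth_flip)

lemma flip_neq [simp]: "i < length u \<Longrightarrow> flip i u \<noteq> u"
  using nth_flip[of i u i] by (metis bit_add_one_neq)

lemma flip_eq_iff:
  assumes "i < length u" "j < length u"
  shows "flip i u = flip j u \<longleftrightarrow> i = j"
  using nth_flip[OF assms(1), of i] nth_flip[OF assms(2), of i]
  by (metis bit_add_one_neq)

lemma flip_flip_eq_iff:
  assumes "i < length u" "j < length u"
  shows "flip i (flip j u) = u \<longleftrightarrow> i = j"
  by (metis assms flip_eq_iff flip_flip length_flip)

text \<open>Since the common endpoint is not \<open>u\<close>, both pairs consist of different
  directions. The endpoint then differs from \<open>u\<close> at \<open>i\<close> and at
  \<open>j\<close>, so each of these must be among \<open>k\<close> and \<open>l\<close>. This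
  bounds the number of common neighbours by two and fixes the shape of a 4-cycle.\<close>

lemma flip_flip_eq_cases:
  assumes "i < length u" "j < length u" "k < length u" "l < length u"
    and "flip l (flip k u) = flip j (flip i u)" "flip j (flip i u) \<noteq> u"
  shows "k = i \<and> l = j \<or> k = j \<and> l = i"
proof -
  have ij: "i \<noteq> j" using assms by auto
  have kl: "k \<noteq> l" using assms by auto
  have *: "flip l (flip k u) ! m = flip j (flip i u) ! m" for m using assms by simp
  have "i = k \<or> i = l"
  proof (rule ccontr)
    assume "\<not> (i = k \<or> i = l)"
    then have "u ! i = u ! i + 1" using *[of i] ij assms(1-4) by (simp add: nth_flip)
    then show False by (metis bit_add_one_neq)
  qed
  moreover have "j = k \<or> j = l"
  proof (rule ccontr)
    assume "\<not> (j = k \<or> j = l)"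
    then have "u ! j = u ! j + 1" using *[of j] ij assms(1-4) by (simp add: nth_flip)
    then show False by (metis bit_add_one_neq)
  qed
  ultimately show ?thesis using ij kl by auto
qed

section \<open>Edges, finiteness and size of the cube\<close>

lemma flip_iff_card:
  assumes "length u = n" "length v = n"
  shows "card {i. i < n \<and> u ! i \<noteq> v ! i} = 1 \<longleftrightarrow> (\<exists>i<n. v = flip i u)"
proof
  assume "card {i. i < n \<and> u ! i \<noteq> v ! i} = 1"
  then obtain i where i: "{i. i < n \<and> u ! i \<noteq> v ! i} = {i}"
    by (auto simp: card_1_singleton_iff)
  then have "i < n" by auto
  moreover have "v = flip i u"
  proof (rule nth_equalityI)
    fix k assume "k < length v"
    then have "u ! k \<noteq> v ! k \<longleftrightarrow> k = i" using i assms by auto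
    then show "v ! k = flip i u ! k"
      using \<open>i < n\<close> assms bit_neq_iff[of "v ! k" "u ! k"] by (auto simp: nth_flip)
  qed (simp add: assms)
  ultimately show "\<exists>i<n. v = flip i u" by blast
next
  assume "\<exists>i<n. v = flip i u"
  then obtain i where "i < n" "v = flip i u" by blast
  then have "{i. i < n \<and> u ! i \<noteq> v ! i} = {i}"
    using assms by (auto simp: nth_flip)
  then show "card {i. i < n \<and> u ! i \<noteq> v ! i} = 1" by simp
qed

lemma cube_edge_iff:
  "{u, v} \<in> cube_edges n \<longleftrightarrow> length u = n \<and> (\<exists>i<n. v = flip i u)"
proof
  assume "{u, v} \<in> cube_edges n"
  then obtain x y where xy: "{u, v} = {x, y}" "length x = n" "length y = n"
    and card: "card {i. i < n \<and> x ! i \<noteq> y ! i} = 1"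
    unfolding cube_edges_def cube_verts_def mem_Collect_eq by metis
  obtain i where i: "i < n" "y = flip i x" using card flip_iff_card[OF xy(2,3)] by blast
  \<comment> \<open>The edge is unordered, so \<open>u\<close> may be either \<open>x\<close> or
    \<open>y\<close>; since a flip is an involution, the same direction serves both cases.\<close>
  have "x = flip i y" using i xy(2) by simp
  with i xy show "length u = n \<and> (\<exists>i<n. v = flip i u)"
    unfolding doubleton_eq_iff by metis
next
  assume uv: "length u = n \<and> (\<exists>i<n. v = flip i u)"
  then have v: "length v = n" by auto
  have "card {i. i < n \<and> u ! i \<noteq> v ! i} = 1"
    using uv v flip_iff_card by blast
  with uv v show "{u, v} \<in> cube_edges n"
    unfolding cube_edges_def cube_verts_def mem_Collect_eq
    by (intro exI[of _ u] exI[of _ v] conjI refl) simp_all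
qed

lemma UNIV_bit: "(UNIV :: bit set) = {0, 1}"
  by (auto intro: bit.exhaust)

text \<open>This is the shape that the library facts on lists of fixed length over a finite alphabet
  expect.\<close>

lemma cube_verts_eq: "cube_verts n = {u. set u \<subseteq> {0, 1} \<and> length u = n}"
  unfolding cube_verts_def UNIV_bit[symmetric] by simp

lemma finite_cube_verts [simp]: "finite (cube_verts n)"
  unfolding cube_verts_eq by (rule finite_lists_length_eq) simp

lemma card_cube_verts: "card (cube_verts n) = 2 ^ n"
  unfolding cube_verts_eq by (subst card_lists_length_eq) (auto simp: numeral_2_eq_2)

lemma finite_cube_edges [simp]: "finite (cube_edges n)"
  by (rule finite_subset[of _ "Pow (cube_verts n)"]) (auto simp: cube_edges_def)

section \<open>4-cycles of the cube\<close>

lemma all_less_4: "(\<forall>i<4. P i) \<longleftrightarrow> P 0 \<and> P 1 \<and> P 2 \<and> P (3 :: nat)"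
  by (auto simp: eval_nat_numeral less_Suc_eq)

lemma ex_less_4: "(\<exists>i<4. P i) \<longleftrightarrow> P 0 \<or> P 1 \<or> P 2 \<or> P (3 :: nat)"
  by (auto simp: eval_nat_numeral less_Suc_eq)

lemma is_cycle_4:
  "is_cycle E [a, b, c, d] \<longleftrightarrow>
    distinct [a, b, c, d] \<and> {a, b} \<in> E \<and> {b, c} \<in> E \<and> {c, d} \<in> E \<and> {d, a} \<in> E"
proof -
  have "length [a, b, c, d] = 4" by simp
  then show ?thesis unfolding is_cycle_def by (simp only: all_less_4) simp
qed

lemma cycle_edges_4: "cycle_edges [a, b, c, d] = {{a, b}, {b, c}, {c, d}, {d, a}}"
proof -
  have "length [a, b, c, d] = 4" by simp
  then have mem: "e \<in> cycle_edges [a, b, c, d] \<longleftrightarrow>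
      (\<exists>i<4. e = {[a, b, c, d] ! i, [a, b, c, d] ! (Suc i mod 4)})" for e
    unfolding cycle_edges_def by (simp only: mem_Collect_eq) blast
  show ?thesis by (rule Set.set_eqI) (simp only: mem ex_less_4, simp)
qed

lemma sum_4:
  fixes f :: "'a \<Rightarrow> 'b :: comm_monoid_add"
  assumes "distinct [a, b, c, d]"
  shows "sum f {a, b, c, d} = f a + f b + f c + f d"
  using assms by (simp add: add.assoc)

lemma unbalanced_4:
  assumes "finite E" "is_cycle E [a, b, c, d]"
  shows "unbalanced E s [a, b, c, d] \<longleftrightarrow> s {a, b} + s {b, c} + s {c, d} + s {d, a} = 1"
proof -
  have sub: "cycle_edges [a, b, c, d] \<subseteq> E" and ne: "distinct [a, b, c, d]"
    using assms(2) by (auto simp: is_cycle_4 cycle_edges_4)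
  have "dot E s (cycle_indicator [a, b, c, d]) = (\<Sum>e\<in>cycle_edges [a, b, c, d]. s e)"
    unfolding dot_def cycle_indicator_def using sub assms(1)
    by (intro sum.mono_neutral_cong_right) auto
  also have "\<dots> = s {a, b} + s {b, c} + s {c, d} + s {d, a}"
    \<comment> \<open>The edges form a set, so equal ones would be counted once; distinctness of the
      four vertices makes the four edges distinct.\<close>
    unfolding cycle_edges_4 by (rule sum_4) (use ne in \<open>auto simp: doubleton_eq_iff\<close>)
  finally show ?thesis by (simp add: unbalanced_def)
qed

lemma cube_4_cycle:
  assumes "length u = n" "i < n" "j < n" "i \<noteq> j"
  shows "is_cycle (cube_edges n) [u, flip i u, flip j (flip i u), flip j u]"
proof -
  let ?w = "flip j (flip i u)"
  \<comment> \<open>Taking the flips in the other order exhibits \<open>?w\<close> as the neighbour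
    of \<open>flip j u\<close> in direction \<open>i\<close>, which gives the third edge of the
    cycle.\<close>
  have w: "?w = flip i (flip j u)" using assms by (simp add: flip_commute)
  have "flip i u \<noteq> u" "flip j u \<noteq> u" "flip i u \<noteq> flip j u" "?w \<noteq> u"
    using assms by (simp_all add: flip_eq_iff flip_flip_eq_iff)
  moreover have "?w \<noteq> flip i u" using assms by simp
  moreover have "?w \<noteq> flip j u" unfolding w using assms by simp
  moreover have "{u, flip i u} \<in> cube_edges n" "{flip i u, ?w} \<in> cube_edges n"
      "{flip j u, ?w} \<in> cube_edges n" "{u, flip j u} \<in> cube_edges n"
    using assms w by (auto simp: cube_edge_iff)
  ultimately show ?thesis by (auto simp: is_cycle_4 insert_commute)
qed

text \<open>The vertex opposite to \<open>u\<close> is reached by two paths of two flips each. By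
  \<open>flip_flip_eq_cases\<close> they use the same two directions, and as their middle vertices
  differ, they use them in opposite orders.\<close>

lemma cube_4_cycleE:
  assumes "is_cycle (cube_edges n) c" "length c = 4"
  obtains u i j where "length u = n" "i < n" "j < n" "i \<noteq> j"
    "c = [u, flip i u, flip j (flip i u), flip j u]"
proof -
  obtain u v w x where c: "c = [u, v, w, x]"
    using assms(2) by (auto simp: numeral_eq_Suc length_Suc_conv)
  have "is_cycle (cube_edges n) [u, v, w, x]" using assms(1) c by simp
  then have ne: "u \<noteq> w" "v \<noteq> x" and uv: "{u, v} \<in> cube_edges n" and vw: "{v, w} \<in> cube_edges n"
    and xw: "{x, w} \<in> cube_edges n" and ux: "{u, x} \<in> cube_edges n"
    unfolding is_cycle_4 by (simp_all add: insert_commute)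
  from uv obtain i where u: "length u = n" and i: "i < n" "v = flip i u"
    unfolding cube_edge_iff by blast
  from vw obtain j where j: "j < n" "w = flip j v" unfolding cube_edge_iff by blast
  from ux obtain k where k: "k < n" "x = flip k u" unfolding cube_edge_iff by blast
  from xw obtain l where l: "l < n" "w = flip l x" unfolding cube_edge_iff by blast
  have "k = i \<and> l = j \<or> k = j \<and> l = i"
  proof (rule flip_flip_eq_cases)
    show "flip l (flip k u) = flip j (flip i u)"
      unfolding i(2)[symmetric] k(2)[symmetric] j(2)[symmetric] l(2)[symmetric] by (rule refl)
    show "flip j (flip i u) \<noteq> u"
      unfolding i(2)[symmetric] j(2)[symmetric] using ne(1) by (rule not_sym)
  qed (simp_all only: u i(1) j(1) k(1) l(1))
  then have "k = j" using i(2) k(2) ne(2) by metis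
  moreover have "i \<noteq> j" using ne(1) flip_flip[of i u] u i(1) unfolding j(2) i(2) by metis
  moreover have "c = [u, flip i u, flip j (flip i u), flip k u]"
    unfolding c i(2)[symmetric] k(2)[symmetric] j(2)[symmetric] by (rule refl)
  ultimately show thesis using that u i(1) j(1) by metis
qed

section \<open>An explicit solution of the linear system\<close>

definition prefix_parity :: "nat \<Rightarrow> bit list \<Rightarrow> bit" where
  "prefix_parity i u = (\<Sum>k<i. u ! k)"

lemma prefix_parity_flip:
  assumes "j < length u"
  shows "prefix_parity i (flip j u) = prefix_parity i u + of_bool (j < i)"
proof -
  have "prefix_parity i (flip j u) = (\<Sum>k<i. u ! k + (if k = j then 1 else 0))"
    unfolding prefix_parity_def using assms by (intro sum.cong) (simp_all add: nth_flip)
  also have "\<dots> = prefix_parity i u + (\<Sum>k<i. if k = j then 1 else 0)"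
    unfolding prefix_parity_def by (rule sum.distrib)
  also have "(\<Sum>k<i. if k = j then 1 else 0) = (of_bool (j < i) :: bit)"
    by simp
  finally show ?thesis .
qed

text \<open>An edge is a bare set that records neither a direction nor a preferred endpoint, so both
  are quantified over; \<open>parity_signing_edge\<close> shows that the choice does not
  matter.\<close>

definition parity_signing :: "bit list set \<Rightarrow> bit" where
  "parity_signing e =
    of_bool (\<exists>u i. i < length u \<and> e = {u, flip i u} \<and> prefix_parity i u = 1)"

text \<open>An edge has only two presentations, one from each endpoint and both in direction
  \<open>i\<close>. The prefix sum stops before coordinate \<open>i\<close>, the only one where the
  endpoints differ, so both presentations give the same value.\<close>

lemma parity_signing_edge:
  assumes "i < length u"
  shows "parity_signing {u, flip i u} = prefix_parity i u"
proof -
  have *: "prefix_parity j v = prefix_parity i u"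
    if v: "j < length v" "{u, flip i u} = {v, flip j v}" for j v
  proof -
    from v(2) consider "u = v" "flip i u = flip j v" | "u = flip j v" "flip i u = v"
      unfolding doubleton_eq_iff by blast
    then show ?thesis
    proof cases
      case 1
      have "j = i" using flip_eq_iff[OF assms, of j] v(1) 1(2) unfolding 1(1) by simp
      then show ?thesis unfolding 1(1) by simp
    next
      case 2
      have "i = j" using flip_flip_eq_iff[of i v j] v(1) assms 2(2) unfolding 2(1) by simp
      then show ?thesis unfolding 2(1) using v(1) by (simp add: prefix_parity_flip)
    qed
  qed
  have "(\<exists>v j. j < length v \<and> {u, flip i u} = {v, flip j v} \<and> prefix_parity j v = 1)
      \<longleftrightarrow> prefix_parity i u = 1" (is "?P \<longleftrightarrow> ?Q")
  proof (intro iffI)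
    assume ?P
    then show ?Q using * by (elim exE conjE) (simp only:)
  next
    assume ?Q
    then show ?P using assms by blast
  qed
  then show ?thesis
    unfolding parity_signing_def by (cases "prefix_parity i u") simp_all
qed

lemma parity_signing_solution: "parity_signing \<in> cube_solutions n"
proof -
  have "unbalanced (cube_edges n) parity_signing c"
    if c: "is_cycle (cube_edges n) c" "length c = 4" for c
  proof -
    from c obtain u i j where u: "length u = n" "i < n" "j < n" "i \<noteq> j"
      and c_eq: "c = [u, flip i u, flip j (flip i u), flip j u]"
      by (rule cube_4_cycleE)
    have "parity_signing {flip i u, flip j (flip i u)} = prefix_parity j u + of_bool (i < j)"
      using u by (simp add: parity_signing_edge prefix_parity_flip)
    moreover have "parity_signing {flip j (flip i u), flip j u}
        = prefix_parity i u + of_bool (j < i)"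
    proof -
      have "{flip j (flip i u), flip j u} = {flip j u, flip i (flip j u)}"
        using u flip_commute[of j u i] by (simp add: insert_commute)
      then show ?thesis using u by (simp only:) (simp add: parity_signing_edge prefix_parity_flip)
    qed
    moreover have "parity_signing {flip j u, u} = prefix_parity j u"
      using u parity_signing_edge[of j u] by (simp add: insert_commute)
    moreover have "parity_signing {u, flip i u} = prefix_parity i u"
      using u by (simp add: parity_signing_edge)
    \<comment> \<open>Here \<open>p\<close> and \<open>q\<close> stand for the prefix parities of
      \<open>u\<close> at \<open>i\<close> and at \<open>j\<close>. Each occurs twice and cancels,
      while exactly one of \<open>i < j\<close> and \<open>j < i\<close> holds.\<close>
    moreover have "p + (q + of_bool (i < j)) + (p + of_bool (j < i)) + q = 1" for p q :: bit
      using \<open>i \<noteq> j\<close> by (cases p; cases q) auto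
    ultimately show ?thesis
      using c(1) unfolding c_eq by (subst unbalanced_4) auto
  qed
  then show ?thesis by (simp add: cube_solutions_def)
qed

section \<open>Entries of the squared signed adjacency matrix\<close>

definition signed_adj :: "'v set set \<Rightarrow> ('v set \<Rightarrow> real) \<Rightarrow> 'v \<Rightarrow> 'v \<Rightarrow> real" where
  "signed_adj E \<sigma> u v = (if {u, v} \<in> E then \<sigma> {u, v} else 0)"

lemma signing_square [simp]: "signing s e * signing s e = 1"
  by (simp add: signing_def)

text \<open>An odd number of the four signs is -1, so their product is -1 and the two pairwise
  products are opposite. The pairing matches the two paths between opposite corners of a 4-cycle
  traversed as \<open>a\<close>, \<open>b\<close>, \<open>c\<close>, \<open>d\<close>.\<close>

lemma signing_quadruple:
  assumes "s a + s b + s c + s d = 1"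
  shows "signing s a * signing s b + signing s d * signing s c = 0"
  using assms by (cases "s a"; cases "s b"; cases "s c"; cases "s d") (auto simp: signing_def)

text \<open>The row of \<open>u\<close> is supported on its neighbours, and different directions
  lead to different neighbours, so the sum may run over directions.\<close>

lemma sum_cube_neighbours:
  assumes "length u = n"
  shows "(\<Sum>w\<in>cube_verts n. signed_adj (cube_edges n) \<sigma> u w * f w)
    = (\<Sum>i<n. \<sigma> {u, flip i u} * f (flip i u))"
proof -
  have "(\<Sum>w\<in>cube_verts n. signed_adj (cube_edges n) \<sigma> u w * f w)
      = (\<Sum>w\<in>(\<lambda>i. flip i u) ` {..<n}. \<sigma> {u, w} * f w)"
  proof (rule sum.mono_neutral_cong_right)
    show "(\<lambda>i. flip i u) ` {..<n} \<subseteq> cube_verts n"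
      using assms by (auto simp: cube_verts_def)
    show "\<forall>w\<in>cube_verts n - (\<lambda>i. flip i u) ` {..<n}.
        signed_adj (cube_edges n) \<sigma> u w * f w = 0"
      unfolding signed_adj_def cube_edge_iff by auto
    show "signed_adj (cube_edges n) \<sigma> u w * f w = \<sigma> {u, w} * f w"
      if "w \<in> (\<lambda>i. flip i u) ` {..<n}" for w
    proof -
      have "{u, w} \<in> cube_edges n" using that assms unfolding cube_edge_iff by blast
      then show ?thesis by (simp add: signed_adj_def)
    qed
  qed simp
  also have "\<dots> = (\<Sum>i<n. \<sigma> {u, flip i u} * f (flip i u))"
    using assms by (subst sum.reindex) (auto simp: inj_on_def flip_eq_iff)
  finally show ?thesis .
qed

lemma cube_adj_square_entry:
  assumes s: "s \<in> cube_solutions n" and u: "length u = n" and v: "length v = n"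
  shows "(\<Sum>w\<in>cube_verts n. signed_adj (cube_edges n) (signing s) u w *
      signed_adj (cube_edges n) (signing s) w v) = (if u = v then real n else 0)"
proof -
  let ?a = "signed_adj (cube_edges n) (signing s)"
  \<comment> \<open>The contribution of the walk from \<open>u\<close> to \<open>v\<close> whose
    first step is in direction \<open>i\<close>.\<close>
  let ?f = "\<lambda>i. signing s {u, flip i u} * ?a (flip i u) v"
  have S: "(\<Sum>w\<in>cube_verts n. ?a u w * ?a w v) = (\<Sum>i<n. ?f i)"
    using u by (rule sum_cube_neighbours)
  have edge: "?a x (flip j x) = signing s {x, flip j x}" if "length x = n" "j < n" for x j
    using that by (auto simp: signed_adj_def cube_edge_iff)
  show ?thesis
  proof (cases "u = v")
    case True
    \<comment> \<open>A closed walk of length two traverses one edge back and forth, so its sign is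
      squared.\<close>
    have "?f i = 1" if "i < n" for i
      using edge[of "flip i u" i] that u True by (simp add: insert_commute)
    then show ?thesis using S True by simp
  next
    case False
    show ?thesis
    proof (cases "\<exists>i<n. \<exists>j<n. v = flip j (flip i u)")
      case True
      then obtain i j where ij: "i < n" "j < n" "v = flip j (flip i u)" by blast
      have "i \<noteq> j" using ij False u by auto
      \<comment> \<open>A walk to \<open>v\<close> starting in direction \<open>k\<close> would
        reach \<open>v\<close> by a second pair of flips, which \<open>flip_flip_eq_cases\<close>
        rules out.\<close>
      have zero: "?f k = 0" if k: "k < n" "k \<notin> {i, j}" for k
      proof -
        have "v \<noteq> flip l (flip k u)" if "l < n" for l
          using flip_flip_eq_cases[of i u j k l] ij k u False that by auto
        then show ?thesis by (auto simp: signed_adj_def cube_edge_iff)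
      qed
      let ?c = "[u, flip i u, v, flip j u]"
      have cyc: "is_cycle (cube_edges n) ?c"
        using cube_4_cycle[OF u ij(1,2) \<open>i \<noteq> j\<close>] ij(3) by simp
      then have "unbalanced (cube_edges n) s ?c"
        using s by (simp add: cube_solutions_def)
      then have "s {u, flip i u} + s {flip i u, v} + s {v, flip j u} + s {flip j u, u} = 1"
        using cyc by (simp add: unbalanced_4)
      then have "signing s {u, flip i u} * signing s {flip i u, v} +
          signing s {u, flip j u} * signing s {flip j u, v} = 0"
        using signing_quadruple by (simp add: insert_commute)
      moreover have "?a (flip i u) v = signing s {flip i u, v}"
        using edge[of "flip i u" j] ij u by simp
      moreover have "?a (flip j u) v = signing s {flip j u, v}"
        using edge[of "flip j u" i] ij u by (simp add: flip_commute)
      ultimately have "?f i + ?f j = 0" by simp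
      moreover have "(\<Sum>k<n. ?f k) = (\<Sum>k\<in>{i, j}. ?f k)"
        using ij zero by (intro sum.mono_neutral_right) auto
      ultimately show ?thesis using S False \<open>i \<noteq> j\<close> by simp
    next
      \<comment> \<open>Now no neighbour of \<open>u\<close> is adjacent to \<open>v\<close>, so
        every term vanishes.\<close>
      case no: False
      then have "?f i = 0" if "i < n" for i
        using that by (auto simp: signed_adj_def cube_edge_iff)
      then have "(\<Sum>i<n. ?f i) = 0" by (intro sum.neutral ballI) (simp only: lessThan_iff)
      then show ?thesis using S False by simp
    qed
  qed
qed

section \<open>From entries to the matrix identity and the spectral radius\<close>

lemma cube_adj_mat_square:
  assumes s: "s \<in> cube_solutions n" and vs: "distinct vs" "set vs = cube_verts n"
  shows "signed_adj_mat vs (cube_edges n) (signing s) ^\<^sub>m 2 = real n \<cdot>\<^sub>m 1\<^sub>m (2 ^ n)"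
proof -
  let ?A = "signed_adj_mat vs (cube_edges n) (signing s)"
  let ?a = "signed_adj (cube_edges n) (signing s)"
  have len: "length vs = 2 ^ n"
    using vs card_cube_verts by (metis distinct_card)
  have A: "?A \<in> carrier_mat (2 ^ n) (2 ^ n)" by (simp add: signed_adj_mat_def len)
  have "?A * ?A = real n \<cdot>\<^sub>m 1\<^sub>m (2 ^ n)"
  proof (rule eq_matI)
    fix i j
    assume "i < dim_row (real n \<cdot>\<^sub>m 1\<^sub>m (2 ^ n))" "j < dim_col (real n \<cdot>\<^sub>m 1\<^sub>m (2 ^ n))"
    then have ij: "i < 2 ^ n" "j < 2 ^ n" by auto
    then have mem: "length (vs ! i) = n" "length (vs ! j) = n"
      using vs len nth_mem[of _ vs] by (auto simp: cube_verts_def)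
    have "(?A * ?A) $$ (i, j) = (\<Sum>k<2 ^ n. ?a (vs ! i) (vs ! k) * ?a (vs ! k) (vs ! j))"
      using ij
      by (simp add: signed_adj_mat_def signed_adj_def scalar_prod_def len lessThan_atLeast0)
    also have "\<dots> = (\<Sum>w\<in>cube_verts n. ?a (vs ! i) w * ?a w (vs ! j))"
      \<comment> \<open>As \<open>vs\<close> lists every vertex once, summing over indices is
        summing over vertices; the same distinctness later turns equality of vertices into equality
        of indices.\<close>
      using bij_betw_nth[OF vs(1) refl refl] unfolding len vs(2)
      by (rule sum.reindex_bij_betw)
    also have "\<dots> = (if vs ! i = vs ! j then real n else 0)"
      using s mem by (rule cube_adj_square_entry)
    also have "\<dots> = (real n \<cdot>\<^sub>m 1\<^sub>m (2 ^ n)) $$ (i, j)"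
      using ij vs(1) len by (simp add: nth_eq_iff_index_eq)
    finally show "(?A * ?A) $$ (i, j) = (real n \<cdot>\<^sub>m 1\<^sub>m (2 ^ n)) $$ (i, j)" .
  qed (use A in auto)
  then show ?thesis using A by (simp add: numeral_2_eq_2)
qed

text \<open>Applying \<open>A\<close> twice to an eigenvector for \<open>k\<close> gives
  \<open>k ^ 2 = r\<close>, so every eigenvalue has modulus \<open>sqrt r\<close>. Positive
  dimension makes the spectrum non-empty, so the maximum is taken over the singleton of
  \<open>sqrt r\<close>.\<close>

lemma spectral_radius_of_scalar_square:
  fixes A :: "complex mat"
  assumes A: "A \<in> carrier_mat m m" and "m > 0" and sq: "A * A = of_real r \<cdot>\<^sub>m 1\<^sub>m m" and "r \<ge> 0"
  shows "spectral_radius A = sqrt r"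
proof -
  have "norm k = sqrt r" if "k \<in> spectrum A" for k
  proof -
    from that obtain v where v: "v \<in> carrier_vec m" "v \<noteq> 0\<^sub>v m" "A *\<^sub>v v = k \<cdot>\<^sub>v v"
      using A by (auto simp: spectrum_def eigenvalue_def eigenvector_def)
    have "of_real r \<cdot>\<^sub>v v = (A * A) *\<^sub>v v"
      using v(1) by (auto simp: sq)
    also have "\<dots> = A *\<^sub>v (k \<cdot>\<^sub>v v)"
      using A v by (simp add: assoc_mult_mat_vec)
    also have "\<dots> = k \<cdot>\<^sub>v (k \<cdot>\<^sub>v v)"
      using A v by (simp add: mult_mat_vec)
    finally have eq: "of_real r \<cdot>\<^sub>v v = k \<cdot>\<^sub>v (k \<cdot>\<^sub>v v)" .
    \<comment> \<open>A nonzero coordinate of the eigenvector can be cancelled, which leaves a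
      scalar equation for \<open>k\<close>.\<close>
    obtain i where i: "i < m" "v $ i \<noteq> 0"
      using v(1,2) by (metis carrier_vecD eq_vecI index_zero_vec(1) index_zero_vec(2))
    have "of_real r * v $ i = k * (k * v $ i)"
      using arg_cong[OF eq, of "\<lambda>x. x $ i"] i v(1) by simp
    then have "k ^ 2 = of_real r" using i by (simp add: power2_eq_square)
    then have "norm k ^ 2 = r"
      using \<open>r \<ge> 0\<close> by (metis norm_power norm_of_real abs_of_nonneg)
    then show ?thesis by (metis norm_ge_zero real_sqrt_unique)
  qed
  moreover have "spectrum A \<noteq> {}"
    using spectrum_non_empty[OF A] \<open>m > 0\<close> by simp
  ultimately have "norm ` spectrum A = {sqrt r}" by (auto simp: image_iff)
  then show ?thesis by (simp add: spectral_radius_def)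
qed

theorem proposition5:
  fixes n :: nat
  shows "cube_solutions n \<noteq> {} \<and>
    (\<forall>s \<in> cube_solutions n. \<forall>vs. distinct vs \<and> set vs = cube_verts n \<longrightarrow>
      signed_adj_mat vs (cube_edges n) (signing s) ^\<^sub>m 2 = real n \<cdot>\<^sub>m 1\<^sub>m (2 ^ n) \<and>
      real_spectral_radius (signed_adj_mat vs (cube_edges n) (signing s)) = sqrt (real n))"
proof (intro conjI ballI allI impI)
  show "cube_solutions n \<noteq> {}" using parity_signing_solution by blast
next
  fix s and vs :: "bit list list"
  assume s: "s \<in> cube_solutions n" and vs: "distinct vs \<and> set vs = cube_verts n"
  let ?A = "signed_adj_mat vs (cube_edges n) (signing s)"
  show sq: "?A ^\<^sub>m 2 = real n \<cdot>\<^sub>m 1\<^sub>m (2 ^ n)"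
    using s vs by (intro cube_adj_mat_square) auto
  have "length vs = 2 ^ n"
    using vs card_cube_verts by (metis distinct_card)
  then have A: "?A \<in> carrier_mat (2 ^ n) (2 ^ n)" by (simp add: signed_adj_mat_def)
  let ?C = "map_mat complex_of_real ?A"
  \<comment> \<open>The spectral radius is taken over the complex numbers, so the real identity is
    carried over by the embedding. The dimension \<open>2 ^ n\<close> is positive even for
    \<open>n = 0\<close>.\<close>
  have "?C * ?C = map_mat complex_of_real (?A * ?A)"
    using A by (simp add: of_real_hom.mat_hom_mult)
  also have "?A * ?A = ?A ^\<^sub>m 2" using A by (simp add: numeral_2_eq_2)
  also have "map_mat complex_of_real \<dots> = of_real (real n) \<cdot>\<^sub>m 1\<^sub>m (2 ^ n)"
    unfolding sq by (rule eq_matI) auto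
  finally have "spectral_radius ?C = sqrt (real n)"
    using A by (intro spectral_radius_of_scalar_square[of _ "2 ^ n"]) auto
  then show "real_spectral_radius ?A = sqrt (real n)"
    by (simp add: real_spectral_radius_def)
qed

end
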